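(* (Twin generators.) For every $k\ge 1$, the number of gaps $g=2$ in the cycle of gaps $\mathcal{G}(p_k^\#)$ is $$N_2(p_k^\#)=\prod_{3\le q\le p_k,\ q \text{ prime}} (q-2).$$
   Context: $p_k$ is the $k$-th prime ($p_1=2$). For a prime $p$, $p^\#$ denotes the primorial of $p$, the product of all primes from $2$ up to and including $p$. For an integer $N\ge 2$, the cycle of gaps $\mathcal{G}(N)=g_1 g_2\cdots g_{\phi(N)}$ is the cyclic sequence of differences between consecutive positive integers coprime to $N$, where $g_1$ is the difference between $1$ and the next larger integer coprime to $N$; it has $\phi(N)$ entries, which sum to $N$. $N_2(p^\#)$ is the number of indices $i\in\{1,\dots,\phi(p^\#)\}$ with $g_i=2$ in $\mathcal{G}(p^\#)$. *)

theory Defs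
  imports "HOL-Number_Theory.Number_Theory" "HOL-Library.Infinite_Set"
begin

(* enumerate counts from 0, whereas primes are numbered from 1; only k \<ge> 1 is meaningful. *)
definition nth_prime :: "nat \<Rightarrow> nat" where
  "nth_prime k = enumerate {p. prime p} (k - 1)"

definition primorial :: "nat \<Rightarrow> nat" where
  "primorial p = (\<Prod>q | prime q \<and> q \<le> p. q)"

(* The i-th entry g_i of the cycle of gaps G(N), for N \<ge> 2 and 1 \<le> i \<le> totient N.
   The positive integers coprime to N in increasing order are indexed from 0 and start with 1,
   so g_1 is the difference between 1 and the next one; the subtraction never truncates. *)
definition gap :: "nat \<Rightarrow> nat \<Rightarrow> nat" where
  "gap N i = enumerate {m. 0 < m \<and> coprime m N} i - enumerate {m. 0 < m \<and> coprime m N} (i - 1)"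

definition num_gaps :: "nat \<Rightarrow> nat \<Rightarrow> nat" where
  "num_gaps g N = card {i \<in> {1..totient N}. gap N i = g}"

end

theory Submission
  imports Defs
begin

text \<open>
  A gap 2 in the cycle of an even \<open>N\<close> starts at a residue \<open>m\<close> with \<open>m\<close> and \<open>m + 2\<close> both
  coprime to \<open>N\<close>, since \<open>m + 1\<close> is then even. By the Chinese remainder theorem the number of
  such residues is multiplicative in \<open>N\<close>; it is 1 for \<open>N = 2\<close>, and \<open>q - 2\<close> for an odd prime \<open>q\<close>,
  where only the residues 0 and \<open>-2\<close> are excluded.
\<close>

text \<open>Representatives run from 0 to \<open>N - 1\<close> to match \<open>mod\<close>. Leaving
  \<open>m + 2\<close> unreduced keeps the pair \<open>N - 1\<close>, \<open>N + 1\<close> across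
  the end of the cycle.\<close>

definition twin_totatives :: "nat \<Rightarrow> nat set" where
  "twin_totatives N = {m. m < N \<and> coprime m N \<and> coprime (m + 2) N}"

lemma finite_twin_totatives [simp]: "finite (twin_totatives N)"
  by (rule finite_subset[of _ "{..<N}"]) (auto simp: twin_totatives_def)

lemma coprime_mod_add_iff:
  fixes m c N :: nat
  assumes "N > 0"
  shows "coprime (m mod N + c) N \<longleftrightarrow> coprime (m + c) N"
  by (metis assms coprime_mod_left_iff mod_add_left_eq not_gr_zero)

text \<open>Coprimality to \<open>a * b\<close> splits into coprimality to \<open>a\<close> and to
  \<open>b\<close>, and each of these depends only on the residue, so the Chinese remainder
  bijection restricts to the twin sets.\<close>

lemma card_twin_totatives_mult:
  assumes "coprime a b" "a > 0" "b > 0"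
  shows "card (twin_totatives (a * b)) = card (twin_totatives a) * card (twin_totatives b)"
proof -
  have "bij_betw (\<lambda>m. (m mod a, m mod b)) (twin_totatives (a * b))
          (twin_totatives a \<times> twin_totatives b)"
    unfolding bij_betw_def
  proof (intro conjI inj_onI equalityI subsetI)
    fix x y
    assume "x \<in> twin_totatives (a * b)" "y \<in> twin_totatives (a * b)"
      and "(x mod a, x mod b) = (y mod a, y mod b)"
    then have "x < a * b" "y < a * b" "[x = y] (mod a)" "[x = y] (mod b)"
      by (auto simp: twin_totatives_def cong_def)
    \<comment> \<open>Both \<open>x\<close> and \<open>y\<close> solve the system with residues
      those of \<open>x\<close>, and its solution below \<open>a * b\<close> is unique.\<close>
    then show "x = y"
      using binary_chinese_remainder_unique_nat[OF assms(1), of x x] assms cong_sym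
      by (metis cong_refl neq0_conv)
  next
    fix z
    assume "z \<in> (\<lambda>m. (m mod a, m mod b)) ` twin_totatives (a * b)"
    then show "z \<in> twin_totatives a \<times> twin_totatives b"
      using assms coprime_mod_add_iff[of a _ 2] coprime_mod_add_iff[of b _ 2]
      by (auto simp: twin_totatives_def)
  next
    fix z
    assume "z \<in> twin_totatives a \<times> twin_totatives b"
    then obtain u v where z: "z = (u, v)" "u \<in> twin_totatives a" "v \<in> twin_totatives b"
      by auto
    obtain x where x: "x < a * b" "[x = u] (mod a)" "[x = v] (mod b)"
      using binary_chinese_remainder_unique_nat[OF assms(1), of u v] assms by auto
    have mods: "x mod a = u" "x mod b = v"
      using x z by (auto simp: twin_totatives_def cong_def)
    have "x \<in> twin_totatives (a * b)"
      using x(1) z assms coprime_mod_add_iff[of a x 0] coprime_mod_add_iff[of b x 0]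
        coprime_mod_add_iff[of a x 2] coprime_mod_add_iff[of b x 2]
      by (simp add: twin_totatives_def mods)
    then show "z \<in> (\<lambda>m. (m mod a, m mod b)) ` twin_totatives (a * b)"
      using mods z(1) by auto
  qed
  then show ?thesis
    by (metis bij_betw_same_card card_cartesian_product)
qed

lemma card_twin_totatives_2: "card (twin_totatives 2) = 1"
proof -
  have "twin_totatives 2 = {1}"
    by (auto simp: twin_totatives_def less_2_cases_iff)
  then show ?thesis by simp
qed

lemma card_twin_totatives_prime:
  assumes "prime q" "q \<ge> 3"
  shows "card (twin_totatives q) = q - 2"
proof -
  have iff: "coprime m q \<longleftrightarrow> \<not> q dvd m" for m
    using assms(1) by (metis coprime_commute prime_imp_coprime_nat coprime_absorb_left not_prime_unit)
  have "twin_totatives q = {..<q} - {0, q - 2}"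
  proof (intro equalityI subsetI)
    fix m
    assume "m \<in> twin_totatives q"
    then show "m \<in> {..<q} - {0, q - 2}"
      using assms(2) le_add_diff_inverse2[of 2 q]
      by (auto simp: twin_totatives_def iff simp del: add_2_eq_Suc' intro: gr0I)
  next
    fix m
    assume m: "m \<in> {..<q} - {0, q - 2}"
    have "\<not> q dvd m + 2"
    proof
      assume "q dvd m + 2"
      then obtain c where c: "m + 2 = q * c" by auto
      \<comment> \<open>\<open>c = 1\<close> would mean \<open>m = q - 2\<close>, which is excluded.
        From \<open>c \<ge> 2\<close> the contradiction is
        \<open>m + 2 < q + 2 < 2 * q\<close>.\<close>
      with m assms(2) have "c \<noteq> 0" "c \<noteq> 1" by (auto intro: ccontr)
      then have "q * 2 \<le> q * c" by (intro mult_le_mono2) simp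
      with c have "q * 2 \<le> m + 2" by simp
      then show False using m assms(2) by simp
    qed
    then show "m \<in> twin_totatives q"
      using m by (auto simp: twin_totatives_def iff dest: dvd_imp_le)
  qed
  \<comment> \<open>Exactly two residues are lost: \<open>0\<close> and \<open>q - 2\<close> differ
    because \<open>q \<ge> 3\<close>.\<close>
  then show ?thesis
    using assms(2) by (simp add: card_Diff_subset)
qed

text \<open>The factor 2 stays outside the product so that the induction starts at modulus 2, with
  count 1; each new odd prime is coprime to the modulus built so far.\<close>

lemma card_twin_totatives_prod_primes:
  assumes "finite S" "\<And>q. q \<in> S \<Longrightarrow> prime q \<and> 3 \<le> q"
  shows "card (twin_totatives (2 * \<Prod>S)) = (\<Prod>q\<in>S. q - 2)"
  using assms
proof (induction S rule: finite_induct)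
  case empty
  show ?case using card_twin_totatives_2 by simp
next
  case (insert q S)
  have q: "prime q" "q \<ge> 3" using insert.prems by auto
  have coprime: "coprime q p" if "prime p" "p \<noteq> q" for p
    using that q by (simp add: primes_coprime)
  have "coprime q (2 * \<Prod>S)"
    unfolding coprime_mult_right_iff
  proof
    show "coprime q 2" by (rule coprime) (use q in auto)
    show "coprime q (\<Prod>S)"
      using insert.hyps(2) insert.prems by (intro prod_coprime_right coprime) auto
  qed
  moreover have "2 * \<Prod>S > 0"
    using insert.prems by (auto intro!: prod_pos dest: prime_gt_0_nat)
  ultimately have "card (twin_totatives (q * (2 * \<Prod>S)))
      = card (twin_totatives q) * card (twin_totatives (2 * \<Prod>S))"
    using q by (intro card_twin_totatives_mult) auto
  then show ?case
    using insert q by (simp add: card_twin_totatives_prime mult_ac)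
qed

lemma infinite_coprime_nat:
  fixes N :: nat
  assumes "N > 0"
  shows "infinite {m. 0 < m \<and> coprime m N}"
  unfolding infinite_nat_iff_unbounded
proof
  fix m
  \<comment> \<open>The witness is congruent to 1 modulo \<open>N\<close>, hence coprime to
    it.\<close>
  have "m < m * N + 1"
    using assms by (simp add: le_imp_less_Suc)
  moreover have "coprime (m * N + 1) N"
    using assms by (metis coprime_1_left coprime_mod_left_iff mod_mult_self3 not_gr_zero)
  ultimately show "\<exists>n>m. n \<in> {m. 0 < m \<and> coprime m N}"
    by auto
qed

text \<open>Since \<open>enumerate A\<close> is strictly increasing, the indices with value at most
  \<open>s\<close> form an initial segment; injectivity gives its length.\<close>

lemma enumerate_image_initial_segment:
  fixes A :: "nat set"
  assumes "infinite A"
  shows "enumerate A ` {..<card {a\<in>A. a \<le> s}} = {a\<in>A. a \<le> s}"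
proof -
  let ?I = "{i. enumerate A i \<le> s}"
  have img: "enumerate A ` ?I = {a\<in>A. a \<le> s}"
    using range_enumerate[OF assms] by auto
  have card: "card ?I = card {a\<in>A. a \<le> s}"
    using card_image[OF inj_on_subset[OF inj_enumerate[OF assms] subset_UNIV], of ?I] img
    by simp
  have "\<exists>n. ?I = {..<n}"
  proof (intro exI equalityI subsetI)
    \<comment> \<open>The first index whose value exceeds \<open>s\<close>; one exists because the
      value at index \<open>i\<close> is at least \<open>i\<close>.\<close>
    let ?n = "LEAST i. \<not> enumerate A i \<le> s"
    have "Suc s \<le> enumerate A (Suc s)"
      using le_enumerate[OF assms] by blast
    then have "\<not> enumerate A (Suc s) \<le> s" by simp
    then have n: "\<not> enumerate A ?n \<le> s" by (rule LeastI)
    show "i \<in> {..<?n}" if "i \<in> ?I" for i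
      using that n enumerate_mono_le_iff[OF assms, of ?n i]
      by (metis lessThan_iff mem_Collect_eq not_le order_trans)
    show "i \<in> ?I" if "i \<in> {..<?n}" for i
      using that not_less_Least by blast
  qed
  then show ?thesis
    using img card by auto
qed

text \<open>With the immediate successor missing from \<open>A\<close>, the next element lies at
  distance at least 2.\<close>

lemma enumerate_Suc_eq_add_2_iff:
  fixes A :: "nat set"
  assumes "infinite A" "Suc (enumerate A i) \<notin> A"
  shows "enumerate A (Suc i) - enumerate A i = 2 \<longleftrightarrow> enumerate A i + 2 \<in> A"
proof
  assume "enumerate A (Suc i) - enumerate A i = 2"
  then have "enumerate A (Suc i) = enumerate A i + 2" by simp
  then show "enumerate A i + 2 \<in> A"
    using enumerate_in_set[OF assms(1)] by metis
next
  assume *: "enumerate A i + 2 \<in> A"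
  have "enumerate A (Suc i) = enumerate A i + 2"
    unfolding enumerate_Suc''[OF assms(1)]
  proof (rule Least_equality)
    show "enumerate A i + 2 \<in> A \<and> enumerate A i < enumerate A i + 2"
      using * by simp
    fix s
    assume s: "s \<in> A \<and> enumerate A i < s"
    then have "s \<noteq> Suc (enumerate A i)" using assms(2) by auto
    with s show "enumerate A i + 2 \<le> s" by simp
  qed
  then show "enumerate A (Suc i) - enumerate A i = 2" by simp
qed

lemma num_gaps_2_even:
  assumes "even N" "N > 0"
  shows "num_gaps 2 N = card (twin_totatives N)"
proof -
  let ?A = "{m. 0 < m \<and> coprime m N}"
  let ?e = "enumerate ?A"
  let ?I = "{i\<in>{..<totient N}. ?e i + 2 \<in> ?A}"
  note inf = infinite_coprime_nat[OF assms(2)]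
  \<comment> \<open>Numbers coprime to the even \<open>N\<close> are odd, so their successors share
    the factor 2 with \<open>N\<close>.\<close>
  have "Suc (?e i) \<notin> ?A" for i
    using enumerate_in_set[OF inf, of i] assms(1)
    by (auto dest!: coprime_common_divisor[of _ _ 2])
  then have gap: "gap N (Suc i) = 2 \<longleftrightarrow> ?e i + 2 \<in> ?A" for i
    unfolding gap_def diff_Suc_1 by (rule enumerate_Suc_eq_add_2_iff[OF inf])
  \<comment> \<open>Gaps are numbered from 1 but \<open>enumerate\<close> from 0: gap
    \<open>Suc i\<close> starts at \<open>?e i\<close>.\<close>
  have "{i\<in>{1..totient N}. gap N i = 2} = Suc ` ?I"
  proof (intro equalityI subsetI)
    fix i
    assume i: "i \<in> {i\<in>{1..totient N}. gap N i = 2}"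
    then obtain j where "i = Suc j" by (cases i) auto
    with i gap[of j] show "i \<in> Suc ` ?I" by auto
  qed (use gap in auto)
  then have "num_gaps 2 N = card ?I"
    unfolding num_gaps_def by (simp add: card_image)
  also have "\<dots> = card (?e ` ?I)"
    by (rule card_image[OF inj_on_subset[OF inj_enumerate[OF inf] subset_UNIV], symmetric])
  also have "?e ` ?I = {m \<in> ?e ` {..<totient N}. m + 2 \<in> ?A}"
    by auto
  also have "?e ` {..<totient N} = {m \<in> ?A. m \<le> N}"
  proof -
    have "totatives N = {m \<in> ?A. m \<le> N}"
      by (auto simp: in_totatives_iff)
    then show ?thesis
      using enumerate_image_initial_segment[OF inf, of N] by (simp add: totient_def)
  qed
  \<comment> \<open>The ranges 1 to \<open>N\<close> and 0 to \<open>N - 1\<close> differ only in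
    \<open>N\<close> and 0, neither of which is coprime to \<open>N\<close> when
    \<open>N \<noteq> 1\<close>.\<close>
  also have "{m \<in> {m \<in> ?A. m \<le> N}. m + 2 \<in> ?A} = twin_totatives N"
  proof -
    have "N \<noteq> 1" using assms(1) by auto
    then show ?thesis
      unfolding twin_totatives_def using assms(2) by (auto simp: le_less intro: gr0I)
  qed
  finally show ?thesis .
qed

theorem mainTheorem2:
  fixes k :: nat
  assumes "k \<ge> 1"
  shows "num_gaps 2 (primorial (nth_prime k)) = (\<Prod>q | prime q \<and> 3 \<le> q \<and> q \<le> nth_prime k. q - 2)"
proof -
  let ?p = "nth_prime k"
  let ?S = "{q. prime q \<and> 3 \<le> q \<and> q \<le> ?p}"
  have "prime ?p"
    unfolding nth_prime_def using enumerate_in_set[OF primes_infinite] by blast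
  then have "?p \<ge> 2" by (rule prime_ge_2_nat)
  have fin: "finite ?S" by (rule finite_subset[of _ "{..?p}"]) auto
  have ge3: "3 \<le> q" if "prime q" "q \<noteq> 2" for q :: nat
    using prime_ge_2_nat[OF that(1)] that(2) by simp
  \<comment> \<open>Splitting off the prime 2 makes the primorial visibly even and leaves the odd
    primes of the claimed product.\<close>
  have "{q. prime q \<and> q \<le> ?p} = insert 2 ?S"
    using \<open>?p \<ge> 2\<close> ge3 by auto
  then have primorial: "primorial ?p = 2 * \<Prod>?S"
    unfolding primorial_def using fin by simp
  have "\<Prod>?S > 0" by (rule prod_pos) auto
  then show ?thesis
    unfolding primorial
    using num_gaps_2_even[of "2 * \<Prod>?S"] card_twin_totatives_prod_primes[OF fin] by auto
qed

end
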